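(* Let $n \geq 0$ be an integer, let $j = 4n+3$, and let $k$ be an even positive integer with $k \leq j(j-1)/2$ and $D=\{1,j,k\}$. Write $k = m(j+1) + \overline{k}$ with integers $m \geq 0$ and $0 \leq \overline{k} \leq j$. Then \[ \kappa(D) = \mu(D) = \begin{cases} \frac{n}{2n+1} & \text{if } \overline{k} = 2(n-m) \text{ and } m \leq 2n,\\[2pt] \frac{k-2m}{2(k+1)} & \text{if } \max\{0, 2(n-m+1)\} \leq \overline{k} \leq 2n,\\[2pt] \frac{2n+1}{4n+4} & \text{if } \overline{k} = 2(n+1). \end{cases} \]
   Context: For a set $D$ of positive integers, a $D$-sequence is a set $S$ of nonnegative integers such that $|x-y| \notin D$ for all $x,y \in S$. For $N \geq 0$ write $S[N] = |S \cap \{0,1,\dots,N\}|$. The upper and lower densities of $S$ are $\limsup_{N\to\infty} S[N]/(N+1)$ and $\liminf_{N\to\infty} S[N]/(N+1)$; if they coincide, the common value is the density $\delta(S)$. Define $\mu(D) = \sup\{\delta(S) : S \text{ is a } D\text{-sequence having a density}\}$. For a real $x$, $\|x\|$ denotes the distance from $x$ to the nearest integer, and $\kappa(D) = \sup_{t \in \mathbb{R}} \min_{d \in D} \|td\|$. *)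

theory Defs
  imports "HOL-Analysis.Analysis"
begin

definition D_sequence :: "nat set \<Rightarrow> nat set \<Rightarrow> bool" where
  "D_sequence D S \<longleftrightarrow> (\<forall>x\<in>S. \<forall>y\<in>S. \<bar>int x - int y\<bar> \<notin> int ` D)"

definition count_upto :: "nat set \<Rightarrow> nat \<Rightarrow> nat" where
  "count_upto S N = card (S \<inter> {0..N})"

definition upper_density :: "nat set \<Rightarrow> ereal" where
  "upper_density S = limsup (\<lambda>N. ereal (real (count_upto S N) / (real N + 1)))"

definition lower_density :: "nat set \<Rightarrow> ereal" where
  "lower_density S = liminf (\<lambda>N. ereal (real (count_upto S N) / (real N + 1)))"

definition has_density :: "nat set \<Rightarrow> bool" where
  "has_density S \<longleftrightarrow> upper_density S = lower_density S"

(* Both densities always lie in [0, 1], so the passage from ereal to real loses nothing.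
   Meaningful only if has_density S. *)
definition density_of :: "nat set \<Rightarrow> real" where
  "density_of S = real_of_ereal (upper_density S)"

(* The set below contains 0 (take S empty) and is bounded by 1, so the real supremum is genuine. *)
definition mu :: "nat set \<Rightarrow> real" where
  "mu D = Sup {density_of S | S. D_sequence D S \<and> has_density S}"

definition nearest_int_dist :: "real \<Rightarrow> real" where
  "nearest_int_dist x = \<bar>x - of_int (round x)\<bar>"

(* For finite nonempty D; the supremum is then over values in [0, 1/2]. *)
definition kappa :: "nat set \<Rightarrow> real" where
  "kappa D = (SUP t::real. Min ((\<lambda>d. nearest_int_dist (t * real d)) ` D))"

end

theory Submission
  imports Defs
begin

text \<open>
  Always \<open>\<kappa>(D) \<le> \<mu>(D)\<close>: approximate \<open>t\<close> by \<open>p/q\<close> and take the integers whose multiples of \<open>p\<close>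
  fall in a short arc modulo \<open>q\<close>. Evaluating at \<open>t = a\<close>, where \<open>a\<close> is the claimed value, gives
  \<open>a \<le> \<kappa>(D)\<close>, so it remains to bound the density of a \<open>D\<close>-sequence \<open>S\<close> by \<open>a\<close>.

  In the first case \<open>m\<close> steps \<open>j\<close> and \<open>m + kbar\<close> steps \<open>1\<close> followed by a step \<open>-k\<close> form a closed
  walk of odd length \<open>2n + 1\<close>, each translate of which contains at most \<open>n\<close> elements of \<open>S\<close>.

  In the other cases cut \<open>S\<close> greedily into chunks of density at most \<open>a\<close>. A window of length
  \<open>j + 1\<close> has at most \<open>2n + 1\<close> elements of \<open>S\<close> unless it is perfectly alternating. If no
  alternating window occurs, a chunk of length \<open>k + 1\<close> (second case) or \<open>j + 1\<close> (third case) works.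
  If one occurs, then \<open>S\<close> has at most \<open>k/2\<close> elements in the chunk of length \<open>k + j\<close>, and this
  suffices because \<open>k \<le> j(j-1)/2\<close> forces \<open>m \<le> 2n\<close>.
\<close>

section \<open>Elementary bounds for the distance to the nearest integer, \<open>kappa\<close>,
  densities and \<open>mu\<close>\<close>

lemma D_sequence_add_notin:
  assumes "D_sequence D S" "x \<in> S" "d \<in> D"
  shows "x + d \<notin> S"
  using assms unfolding D_sequence_def by force

lemma nearest_int_dist_le: "nearest_int_dist x \<le> \<bar>x - of_int z\<bar>"
  unfolding nearest_int_dist_def by (rule round_diff_minimal)

lemma nearest_int_dist_ge:
  assumes "of_int z + c \<le> x" "x \<le> of_int z + 1 - c"
  shows "c \<le> nearest_int_dist x"
proof (cases "round x \<le> z")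
  case True
  then have "of_int (round x) \<le> (of_int z :: real)" by simp
  then show ?thesis using assms unfolding nearest_int_dist_def by linarith
next
  case False
  then have "of_int (z + 1) \<le> (of_int (round x) :: real)"
    by (subst of_int_le_iff) simp
  then show ?thesis using assms unfolding nearest_int_dist_def by simp
qed

lemma nearest_int_dist_le_half: "nearest_int_dist x \<le> 1 / 2"
  unfolding nearest_int_dist_def using of_int_round_abs_le[of x] by (simp add: abs_minus_commute)

lemma kappa_ge:
  assumes "finite D" "D \<noteq> {}" "\<And>d. d \<in> D \<Longrightarrow> c \<le> nearest_int_dist (t * real d)"
  shows "c \<le> kappa D"
proof -
  let ?f = "\<lambda>t. Min ((\<lambda>d. nearest_int_dist (t * real d)) ` D)"
  have "?f s \<le> 1 / 2" for s
  proof -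
    obtain d where "d \<in> D" using assms(2) by blast
    then have "?f s \<le> nearest_int_dist (s * real d)" using assms(1) by (intro Min_le) auto
    then show ?thesis using nearest_int_dist_le_half order_trans by blast
  qed
  then have "bdd_above (range ?f)" by (intro bdd_aboveI[of _ "1/2"]) auto
  moreover have "c \<le> ?f t" using assms by (subst Min_ge_iff) auto
  ultimately show ?thesis unfolding kappa_def by (intro cSUP_upper2[where x = t]) auto
qed

text \<open>A constant error \<open>C\<close> vanishes after division by
  \<open>N + 1\<close>.\<close>

lemma density_of_le:
  assumes "\<And>N. real (count_upto S N) \<le> a * (real N + 1) + C"
  shows "density_of S \<le> a"
proof -
  let ?r = "\<lambda>N. real (count_upto S N) / (real N + 1)"
  have le: "?r N \<le> a + C / (real N + 1)" for N
    using divide_right_mono[OF assms[of N], of "real N + 1"] by (simp add: add_divide_distrib)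
  have "(\<lambda>N. C * inverse (real (Suc N))) \<longlonglongrightarrow> C * 0"
    by (intro tendsto_mult tendsto_const LIMSEQ_inverse_real_of_nat)
  then have "(\<lambda>N. C / (real N + 1)) \<longlonglongrightarrow> 0"
    by (simp add: field_simps)
  then have "(\<lambda>N. a + C / (real N + 1)) \<longlonglongrightarrow> a + 0"
    by (intro tendsto_add tendsto_const)
  then have "limsup (\<lambda>N. ereal (a + C / (real N + 1))) = ereal a"
    by (intro lim_imp_Limsup) auto
  moreover have "upper_density S \<le> limsup (\<lambda>N. ereal (a + C / (real N + 1)))"
    unfolding upper_density_def using le by (intro Limsup_mono always_eventually) auto
  ultimately have ub: "upper_density S \<le> ereal a" by simp
  \<comment> \<open>The lower bound excludes minus infinity, which \<open>real_of_ereal\<close>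
    would send to 0.\<close>
  have "liminf (\<lambda>N. ereal (?r N)) \<ge> 0"
    by (intro Liminf_bounded always_eventually) simp
  then have "0 \<le> upper_density S"
    unfolding upper_density_def
    using Liminf_le_Limsup[of sequentially "\<lambda>N. ereal (?r N)"] order_trans by fastforce
  with ub show ?thesis unfolding density_of_def by (cases "upper_density S") auto
qed

lemma mu_le:
  assumes "\<And>S N. D_sequence D S \<Longrightarrow> real (count_upto S N) \<le> a * (real N + 1) + C"
  shows "mu D \<le> a"
  unfolding mu_def
proof (rule cSup_least)
  have "D_sequence D {}" "has_density {}"
    by (auto simp: D_sequence_def has_density_def upper_density_def lower_density_def
        count_upto_def Limsup_const Liminf_const)
  then show "{density_of S |S. D_sequence D S \<and> has_density S} \<noteq> {}" by blast
qed (use density_of_le assms in blast)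

lemma count_upto_le: "count_upto S N \<le> Suc N"
  unfolding count_upto_def using card_mono[of "{0..N}" "S \<inter> {0..N}"] by simp

lemma density_of_le_mu:
  assumes "D_sequence D S" "has_density S"
  shows "density_of S \<le> mu D"
  unfolding mu_def
proof (rule cSup_upper)
  have "density_of S \<le> 1" for S
    using count_upto_le[of S] by (intro density_of_le[of _ _ 0]) (simp flip: of_nat_Suc add: add.commute)
  then show "bdd_above {density_of S |S. D_sequence D S \<and> has_density S}"
    by (intro bdd_aboveI[of _ 1]) auto
qed (use assms in blast)

section \<open>Periodic sets and the inequality \<open>kappa D \<le> mu D\<close>\<close>

text \<open>With \<open>u\<close> full periods below \<open>N + 1\<close>, the count lies between
  \<open>u\<close> and \<open>u + 1\<close> times the count of one period, so the quotient is off by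
  at most \<open>q / (N + 1)\<close>.\<close>

lemma periodic_density:
  assumes "q > 0" and per: "\<And>x. x + q \<in> S \<longleftrightarrow> x \<in> S"
  shows "has_density S" and "density_of S = real (card (S \<inter> {..<q})) / real q"
proof -
  let ?c = "card (S \<inter> {..<q})"
  let ?r = "\<lambda>N. real (count_upto S N) / (real N + 1)"
  have blocks: "card (S \<inter> {..<u * q}) = u * ?c" for u
  proof (induction u)
    case (Suc u)
    have per': "x + u * q \<in> S \<longleftrightarrow> x \<in> S" for x
      by (induction u) (use per in \<open>auto simp: add.assoc[symmetric] add.commute[of q]\<close>)
    have "S \<inter> {..<Suc u * q} = (S \<inter> {..<u * q}) \<union> (\<lambda>x. x + u * q) ` (S \<inter> {..<q})"
    proof (intro equalityI subsetI)
      fix x assume x: "x \<in> S \<inter> {..<Suc u * q}"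
      show "x \<in> (S \<inter> {..<u * q}) \<union> (\<lambda>x. x + u * q) ` (S \<inter> {..<q})"
      proof (cases "x < u * q")
        case False
        then have "x = (x - u * q) + u * q" by simp
        moreover have "x - u * q \<in> S \<inter> {..<q}"
          using False x per'[of "x - u * q"] by auto
        ultimately show ?thesis by blast
      qed (use x in auto)
    qed (use per' in auto)
    moreover have "card ((\<lambda>x. x + u * q) ` (S \<inter> {..<q})) = ?c"
      by (rule card_image) (auto simp: inj_on_def)
    moreover have "(S \<inter> {..<u * q}) \<inter> (\<lambda>x. x + u * q) ` (S \<inter> {..<q}) = {}" by auto
    ultimately show ?case using Suc by (simp add: card_Un_disjoint)
  qed simp
  have cq: "?c \<le> q" using card_mono[of "{..<q}" "S \<inter> {..<q}"] by simp
  have bound: "\<bar>?r N - real ?c / real q\<bar> \<le> real q * inverse (real (Suc N))" for N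
  proof -
    define u where "u = Suc N div q"
    have N: "u * q \<le> Suc N" "Suc N \<le> Suc u * q"
      unfolding u_def using \<open>q > 0\<close> dividend_less_div_times[of q "Suc N"] by auto
    have cnt: "count_upto S N = card (S \<inter> {..<Suc N})"
      unfolding count_upto_def by (rule arg_cong[of _ _ card]) auto
    have "u * ?c \<le> count_upto S N" "count_upto S N \<le> Suc u * ?c"
      unfolding cnt blocks[symmetric] using N by (auto intro!: card_mono)
    then have "real (u * ?c) \<le> real (count_upto S N)" "real (count_upto S N) \<le> real (Suc u * ?c)"
      by (simp_all only: of_nat_le_iff)
    moreover have "real (u * q) \<le> real (Suc N)" "real (Suc N) \<le> real (Suc u * q)"
      using N by (simp_all only: of_nat_le_iff)
    ultimately have h: "real u * ?c \<le> real (count_upto S N)" "real (count_upto S N) \<le> real u * ?c + ?c"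
      "real u * q \<le> real (Suc N)" "real (Suc N) \<le> real u * q + q"
      by (simp_all add: algebra_simps)
    have m: "real u * q * ?c \<le> real (Suc N) * ?c" "real (Suc N) * ?c \<le> (real u * q + q) * ?c"
      using h(3,4) by (auto intro: mult_right_mono)
    have m2: "q * (real u * ?c) \<le> q * real (count_upto S N)"
      "q * real (count_upto S N) \<le> q * (real u * ?c + ?c)"
      using h(1,2) by (auto intro: mult_left_mono)
    have "real q * ?c \<le> real q * q" using cq by (intro mult_left_mono) auto
    then have "\<bar>q * real (count_upto S N) - real (Suc N) * ?c\<bar> \<le> real q * q"
      using m m2 by (simp add: algebra_simps abs_le_iff)
    moreover have "?r N - real ?c / real q = (q * real (count_upto S N) - real (Suc N) * ?c) / (q * real (Suc N))"
      using \<open>q > 0\<close> by (simp add: field_simps)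
    ultimately have "\<bar>?r N - real ?c / real q\<bar> \<le> (real q * q) / (q * real (Suc N))"
      by (simp only: abs_divide abs_mult abs_of_nat) (intro divide_right_mono, simp_all)
    also have "\<dots> = real q * inverse (real (Suc N))"
      using \<open>q > 0\<close> by (simp add: divide_inverse del: of_nat_Suc)
    finally show ?thesis .
  qed
  have "(\<lambda>N. real q * inverse (real (Suc N))) \<longlonglongrightarrow> real q * 0"
    by (intro tendsto_mult tendsto_const LIMSEQ_inverse_real_of_nat)
  then have lim: "(\<lambda>N. real q * inverse (real (Suc N))) \<longlonglongrightarrow> 0" by (simp only: mult_zero_right)
  have "(\<lambda>N. ?r N - real ?c / real q) \<longlonglongrightarrow> 0"
    by (rule Lim_null_comparison[OF _ lim], rule always_eventually) (simp only: bound real_norm_def simp_thms)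
  then have "(\<lambda>N. ereal (?r N)) \<longlonglongrightarrow> ereal (real ?c / real q)"
    by (simp only: LIM_zero_iff lim_ereal)
  then have "upper_density S = ereal (real ?c / real q)" "lower_density S = ereal (real ?c / real q)"
    unfolding upper_density_def lower_density_def
    by (simp_all only: lim_imp_Limsup lim_imp_Liminf trivial_limit_sequentially not_False_eq_True)
  then show "has_density S" "density_of S = real ?c / real q"
    by (auto simp: has_density_def density_of_def)
qed

text \<open>Averaging over the translations \<open>\<theta>\<close> replaces the count of a single arc, which would
  depend on \<open>gcd p q\<close>.\<close>

lemma ex_dense_rotation_set:
  fixes p :: int
  assumes "q > 0" "b \<le> q"
  shows "\<exists>\<theta>. b \<le> card ({x. (p * int x + \<theta>) mod int q < int b} \<inter> {..<q})"
proof (rule ccontr)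
  assume "\<not> ?thesis"
  then have small: "card {x \<in> {..<q}. (p * int x + \<theta>) mod int q < int b} < b" for \<theta>
    by (auto simp: not_le Int_def conj_commute)
  let ?R = "\<lambda>x \<theta>. (p * int x + \<theta>) mod int q < int b"
  have large: "b \<le> card {\<theta> \<in> {0..<int q}. ?R x \<theta>}" for x
  proof -
    \<comment> \<open>The shift that carries \<open>p * x\<close> to the point \<open>v\<close> of
      the arc.\<close>
    let ?g = "\<lambda>v. (v - p * int x) mod int q"
    have "inj_on ?g {0..<int b}"
    proof (rule inj_onI)
      fix v w assume vw: "v \<in> {0..<int b}" "w \<in> {0..<int b}" "?g v = ?g w"
      then have "(?g v + p * int x) mod int q = (?g w + p * int x) mod int q" by simp
      then have "v mod int q = w mod int q" by (simp add: mod_add_left_eq)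
      then show "v = w" using vw assms by simp
    qed
    then have "card (?g ` {0..<int b}) = b" by (simp add: card_image)
    moreover have "?g ` {0..<int b} \<subseteq> {\<theta> \<in> {0..<int q}. ?R x \<theta>}"
    proof
      fix \<theta> assume "\<theta> \<in> ?g ` {0..<int b}"
      then obtain v where v: "v \<in> {0..<int b}" "\<theta> = ?g v" by blast
      have "(p * int x + \<theta>) mod int q = v mod int q" using v by (simp add: mod_add_right_eq)
      then show "\<theta> \<in> {\<theta> \<in> {0..<int q}. ?R x \<theta>}" using v assms by simp
    qed
    moreover have "finite {\<theta> \<in> {0..<int q}. ?R x \<theta>}"
      by (rule finite_subset[of _ "{0..<int q}"]) auto
    ultimately have "card (?g ` {0..<int b}) \<le> card {\<theta> \<in> {0..<int q}. ?R x \<theta>}"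
      by (intro card_mono)
    then show ?thesis using \<open>card (?g ` {0..<int b}) = b\<close> by (simp only:)
  qed
  have "q * b \<le> (\<Sum>x\<in>{..<q}. card {\<theta> \<in> {0..<int q}. ?R x \<theta>})"
    using sum_mono[of "{..<q}" "\<lambda>_. b"] large by simp
  also have "\<dots> = (\<Sum>\<theta>\<in>{0..<int q}. card {x \<in> {..<q}. ?R x \<theta>})"
    by (rule sum_multicount_gen) auto
  also have "\<dots> < (\<Sum>\<theta>\<in>{0..<int q}. b)"
    using assms small by (intro sum_strict_mono) auto
  finally show False by simp
qed

lemma kappa_le_mu:
  assumes D: "finite D" "D \<noteq> {}"
  shows "kappa D \<le> mu D"
  unfolding kappa_def
proof (rule cSUP_least)
  fix t :: real
  let ?F = "(\<lambda>d. nearest_int_dist (t * real d)) ` D"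
  define \<alpha> where "\<alpha> = Min ?F"
  define M where "M = Max D"
  have \<alpha>: "\<alpha> \<le> nearest_int_dist (t * real d)" if "d \<in> D" for d
    unfolding \<alpha>_def using that D by (intro Min_le) auto
  have "\<alpha> \<le> 1 / 2"
    using D(2) \<alpha> nearest_int_dist_le_half order_trans by blast
  have approx: "\<alpha> - (real M + 1) * inverse (real (Suc r)) \<le> mu D" for r
  proof -
    define q where "q = Suc r"
    \<comment> \<open>The arc is shortened by \<open>M\<close> because replacing
      \<open>t * q\<close> by its floor \<open>p\<close> costs up to \<open>d \<le> M\<close> when
      multiplied by a difference \<open>d\<close>. If the value is negative, \<open>b\<close> is 0
      and the set \<open>S\<close> below is empty.\<close>
    define b where "b = nat \<lfloor>\<alpha> * real q - real M\<rfloor>"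
    define p where "p = \<lfloor>t * real q\<rfloor>"
    have q: "q > 0" unfolding q_def by simp
    have "\<alpha> * real q - real M \<le> real q"
      using mult_right_mono[OF \<open>\<alpha> \<le> 1 / 2\<close>, of "real q"] by simp
    then have "b \<le> q" unfolding b_def by linarith
    then obtain \<theta> where \<theta>: "b \<le> card ({x. (p * int x + \<theta>) mod int q < int b} \<inter> {..<q})"
      using ex_dense_rotation_set[OF q] by blast
    define S where "S = {x. (p * int x + \<theta>) mod int q < int b}"
    have "D_sequence D S"
      unfolding D_sequence_def
    proof (intro ballI notI)
      fix x y assume xy: "x \<in> S" "y \<in> S" "\<bar>int x - int y\<bar> \<in> int ` D"
      then obtain d where d: "d \<in> D" "\<bar>int x - int y\<bar> = int d" by blast
      have dM: "d \<le> M" unfolding M_def using d D by simp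
      define e where "e = (p * int x + \<theta>) mod int q - (p * int y + \<theta>) mod int q"
      define u where "u = (p * int x + \<theta>) div int q - (p * int y + \<theta>) div int q"
      have split: "p * (int x - int y) = int q * u + e"
        unfolding u_def e_def using mult_div_mod_eq[of "int q" "p * int x + \<theta>"]
          mult_div_mod_eq[of "int q" "p * int y + \<theta>"] by (simp add: algebra_simps)
      have range: "0 \<le> (p * int x + \<theta>) mod int q" "0 \<le> (p * int y + \<theta>) mod int q"
        using q by simp_all
      have e: "\<bar>e\<bar> < int b" and "0 < b"
        using xy(1,2) range unfolding S_def e_def by auto
      then have b: "real b \<le> \<alpha> * real q - real M" unfolding b_def by linarith
      \<comment> \<open>Two points of the arc differ by less than \<open>b\<close>; the sign is
        chosen so that the difference of \<open>x\<close> and \<open>y\<close> becomes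
        \<open>d\<close>.\<close>
      obtain u' e' where ue: "p * int d = int q * u' + e'" "\<bar>e'\<bar> < int b"
      proof (cases "int x \<ge> int y")
        case True
        then show ?thesis using d split e that[of u e] by simp
      next
        case False
        then have "int d = - (int x - int y)" using d by simp
        then have "p * int d = - (p * (int x - int y))" by (simp only: mult_minus_right)
        then have "p * int d = int q * (-u) + (-e)" using split by simp
        then show ?thesis using e that[of "-u" "-e"] by simp
      qed
      have "real_of_int (p * int d) = real_of_int (int q * u' + e')" using ue by simp
      then have pd: "real_of_int p * real d = real q * real_of_int u' + real_of_int e'" by simp
      have "\<bar>real_of_int e'\<bar> < real b" using ue(2) by linarith
      have "\<bar>t * real q - real_of_int p\<bar> \<le> 1" unfolding p_def by linarith
      then have "\<bar>t * real q - real_of_int p\<bar> * real d \<le> 1 * real M"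
        using dM by (intro mult_mono) auto
      then have A: "\<bar>(t * real q - real_of_int p) * real d\<bar> \<le> real M" by (simp add: abs_mult)
      have "real q * (t * real d - real_of_int u') = (t * real q - real_of_int p) * real d + real_of_int e'"
        using pd by (simp add: algebra_simps)
      then have "\<bar>real q * (t * real d - real_of_int u')\<bar> < real M + real b"
        using A \<open>\<bar>real_of_int e'\<bar> < real b\<close> by linarith
      then have "real q * \<bar>t * real d - real_of_int u'\<bar> < real q * \<alpha>"
        using b by (simp add: abs_mult mult.commute[of \<alpha>])
      then have "\<bar>t * real d - real_of_int u'\<bar> < \<alpha>" using q by simp
      then show False using \<alpha>[OF d(1)] nearest_int_dist_le[of "t * real d" u'] by linarith
    qed
    moreover have per: "x + q \<in> S \<longleftrightarrow> x \<in> S" for x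
    proof -
      have "p * int (x + q) + \<theta> = p * int x + \<theta> + int q * p" by (simp add: algebra_simps)
      then show ?thesis unfolding S_def by (simp only: mem_Collect_eq mod_mult_self2)
    qed
    ultimately have "real (card (S \<inter> {..<q})) / real q \<le> mu D"
      using density_of_le_mu[of D S] periodic_density[OF q per] by simp
    moreover have "real b / real q \<le> real (card (S \<inter> {..<q})) / real q"
      using \<theta> unfolding S_def by (intro divide_right_mono) auto
    moreover have "\<alpha> * real q - real M - 1 \<le> real b" unfolding b_def by linarith
    then have "\<alpha> - (real M + 1) / real q \<le> real b / real q"
      using divide_right_mono[of "\<alpha> * real q - real M - 1" "real b" "real q"] q
      by (simp add: diff_divide_distrib add_divide_distrib)
    ultimately have "\<alpha> - (real M + 1) / real q \<le> mu D" by linarith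
    then show ?thesis unfolding q_def by (simp only: divide_inverse)
  qed
  have "(\<lambda>r. \<alpha> - (real M + 1) * inverse (real (Suc r))) \<longlonglongrightarrow> \<alpha> - (real M + 1) * 0"
    by (intro tendsto_diff tendsto_mult tendsto_const LIMSEQ_inverse_real_of_nat)
  then have "\<alpha> \<le> mu D"
    using approx by (intro LIMSEQ_le_const2[of _ \<alpha>]) auto
  then show "Min ?F \<le> mu D" unfolding \<alpha>_def .
qed simp

section \<open>From local counts to upper bounds for \<open>mu\<close>\<close>

text \<open>Greedy cutting from the left: a point outside \<open>S\<close> is skipped as an empty
  chunk of length 1, a point of \<open>S\<close> starts a chunk given by the hypothesis, and a
  remainder of length at most \<open>L\<close> is paid for by the additive term.\<close>

lemma count_le_of_dense_chunks:
  fixes a :: real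
  assumes "0 \<le> a"
    and chunk: "\<And>x. x \<in> S \<Longrightarrow> \<exists>l\<ge>1. l \<le> L \<and> real (card (S \<inter> {x..<x + l})) \<le> a * real l"
  shows "real (card (S \<inter> {x..<x + N})) \<le> a * real N + real L"
proof (induction N arbitrary: x rule: less_induct)
  case (less N)
  have step: ?case if l: "1 \<le> l" "l \<le> N" "real (card (S \<inter> {x..<x + l})) \<le> a * real l" for l
  proof -
    have "S \<inter> {x..<x + N} = (S \<inter> {x..<x + l}) \<union> (S \<inter> {x + l..<x + l + (N - l)})"
      using l by auto
    then have "card (S \<inter> {x..<x + N}) \<le> card (S \<inter> {x..<x + l}) + card (S \<inter> {x + l..<x + l + (N - l)})"
      by (simp add: card_Un_le)
    moreover have "real (card (S \<inter> {x + l..<x + l + (N - l)})) \<le> a * real (N - l) + real L"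
      using l by (intro less.IH) simp
    ultimately have "real (card (S \<inter> {x..<x + N})) \<le> a * real l + (a * real (N - l) + real L)"
      using l(3) by linarith
    then show ?thesis using l(2) by (simp add: of_nat_diff algebra_simps)
  qed
  show ?case
  proof (cases "N \<le> L")
    case True
    have "card (S \<inter> {x..<x + N}) \<le> N" using card_mono[of "{x..<x + N}" "S \<inter> {x..<x + N}"] by simp
    moreover have "0 \<le> a * real N" using assms by simp
    ultimately show ?thesis using True by linarith
  next
    case False
    show ?thesis
    proof (cases "x \<in> S")
      case True
      then obtain l where "1 \<le> l" "l \<le> L" "real (card (S \<inter> {x..<x + l})) \<le> a * real l"
        using chunk by blast
      then show ?thesis using step[of l] False by simp
    next
      case x: False
      then have "S \<inter> {x..<x + 1} = {}" by auto
      then have "real (card (S \<inter> {x..<x + 1})) \<le> a * real 1" using \<open>0 \<le> a\<close> by simp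
      then show ?thesis using step[of 1] False by simp
    qed
  qed
qed

lemma mu_le_of_dense_chunks:
  assumes "0 \<le> a"
    and "\<And>S x. D_sequence D S \<Longrightarrow> x \<in> S \<Longrightarrow>
      \<exists>l\<ge>1. l \<le> L \<and> real (card (S \<inter> {x..<x + l})) \<le> a * real l"
  shows "mu D \<le> a"
proof (rule mu_le)
  fix S N assume "D_sequence D S"
  then have "real (card (S \<inter> {0..<0 + Suc N})) \<le> a * real (Suc N) + real L"
    using assms by (intro count_le_of_dense_chunks) auto
  moreover have "{0..<Suc N} = {0..N}" by auto
  ultimately show "real (count_upto S N) \<le> a * (real N + 1) + real L"
    unfolding count_upto_def by (simp add: add.commute)
qed

text \<open>Double counting of the pairs \<open>x \<le> N\<close>, \<open>i < h\<close> with
  \<open>x + f i \<in> S\<close>. Each \<open>i\<close> catches all elements of \<open>S\<close> up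
  to \<open>N\<close> except those below \<open>f i\<close>, so the total loss does not depend on
  \<open>N\<close>.\<close>

lemma mu_le_of_translates:
  fixes f :: "nat \<Rightarrow> nat"
  assumes "h > 0"
    and trans: "\<And>S x. D_sequence D S \<Longrightarrow> card {i \<in> {..<h}. x + f i \<in> S} \<le> b"
  shows "mu D \<le> real b / real h"
proof (rule mu_le)
  fix S N assume S: "D_sequence D S"
  let ?C = "\<Sum>i<h. f i"
  have "count_upto S N \<le> card {x \<in> {..N}. x + f i \<in> S} + f i" for i
  proof -
    have "S \<inter> {0..N} \<subseteq> (\<lambda>x. x + f i) ` {x \<in> {..N}. x + f i \<in> S} \<union> {..<f i}"
    proof
      fix y assume y: "y \<in> S \<inter> {0..N}"
      show "y \<in> (\<lambda>x. x + f i) ` {x \<in> {..N}. x + f i \<in> S} \<union> {..<f i}"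
      proof (cases "y < f i")
        case False
        then have "y = (y - f i) + f i" by simp
        then show ?thesis using y False by (intro UnI1 image_eqI[of _ _ "y - f i"]) auto
      qed simp
    qed
    then have "count_upto S N \<le> card ((\<lambda>x. x + f i) ` {x \<in> {..N}. x + f i \<in> S} \<union> {..<f i})"
      unfolding count_upto_def by (intro card_mono) auto
    also have "\<dots> \<le> card ((\<lambda>x. x + f i) ` {x \<in> {..N}. x + f i \<in> S}) + card {..<f i}"
      by (rule card_Un_le)
    also have "\<dots> \<le> card {x \<in> {..N}. x + f i \<in> S} + f i"
      by (simp add: card_image_le)
    finally show ?thesis .
  qed
  then have "(\<Sum>i<h. count_upto S N) \<le> (\<Sum>i<h. card {x \<in> {..N}. x + f i \<in> S} + f i)"
    by (intro sum_mono)
  also have "\<dots> = (\<Sum>i<h. card {x \<in> {..N}. x + f i \<in> S}) + ?C" by (rule sum.distrib)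
  also have "(\<Sum>i<h. card {x \<in> {..N}. x + f i \<in> S}) = (\<Sum>x\<le>N. card {i \<in> {..<h}. x + f i \<in> S})"
    by (rule sum_multicount_gen) auto
  also have "\<dots> \<le> (\<Sum>x\<le>N. b)" using trans[OF S] by (intro sum_mono)
  finally have "h * count_upto S N \<le> Suc N * b + ?C" by simp
  then have "real (h * count_upto S N) \<le> real (Suc N * b + ?C)" by (simp only: of_nat_le_iff)
  then have "real h * real (count_upto S N) \<le> (real N + 1) * real b + real ?C"
    by (simp add: algebra_simps del: of_nat_sum)
  then show "real (count_upto S N) \<le> real b / real h * (real N + 1) + real ?C / real h"
    using \<open>h > 0\<close> by (simp add: field_simps del: of_nat_sum)
qed

section \<open>Counting in sparse sets, windows and alternating runs\<close>

lemma card_rows_le: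
  assumes "\<And>i. i < m \<Longrightarrow> card (S \<inter> {x + i * w..<x + i * w + w}) \<le> c"
  shows "card (S \<inter> {x..<x + m * w}) \<le> m * (c::nat)"
  using assms
proof (induction m)
  case (Suc m)
  have "S \<inter> {x..<x + Suc m * w} = (S \<inter> {x..<x + m * w}) \<union> (S \<inter> {x + m * w..<x + m * w + w})"
    by auto
  then have "card (S \<inter> {x..<x + Suc m * w})
      \<le> card (S \<inter> {x..<x + m * w}) + card (S \<inter> {x + m * w..<x + m * w + w})"
    by (simp add: card_Un_le)
  moreover have "card (S \<inter> {x..<x + m * w}) \<le> m * c" using Suc by simp
  ultimately show ?case using Suc.prems[of m] by simp
qed simp

text \<open>Each of the \<open>h\<close> pairs of consecutive integers contains at most one
  element.\<close>

lemma card_sparse_le: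
  assumes "\<And>s. s \<in> S \<Longrightarrow> s + 1 \<notin> S"
  shows "card (S \<inter> {x..<x + 2 * h}) \<le> h"
proof -
  have "card (S \<inter> {x + i * 2..<x + i * 2 + 2}) \<le> 1" for i
  proof -
    let ?z = "x + i * 2"
    have "S \<inter> {?z..<?z + 2} \<subseteq> {?z} \<or> S \<inter> {?z..<?z + 2} \<subseteq> {?z + 1}"
    proof (cases "?z \<in> S")
      case True
      then have "?z + 1 \<notin> S" using assms by blast
      have "S \<inter> {?z..<?z + 2} \<subseteq> {?z}"
      proof
        fix s assume s: "s \<in> S \<inter> {?z..<?z + 2}"
        then have "s = ?z \<or> s = ?z + 1" by auto
        then show "s \<in> {?z}" using s \<open>?z + 1 \<notin> S\<close> by auto
      qed
      then show ?thesis ..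
    next
      case False
      have "S \<inter> {?z..<?z + 2} \<subseteq> {?z + 1}"
      proof
        fix s assume s: "s \<in> S \<inter> {?z..<?z + 2}"
        then have "s = ?z \<or> s = ?z + 1" by auto
        then show "s \<in> {?z + 1}" using s False by auto
      qed
      then show ?thesis ..
    qed
    then show ?thesis
      using card_mono[of "{?z}" "S \<inter> {?z..<?z + 2}"] card_mono[of "{?z + 1}" "S \<inter> {?z..<?z + 2}"]
      by auto
  qed
  then show ?thesis using card_rows_le[of h S x 2 1] by (simp add: mult.commute)
qed

lemma window_sparse_or_alternating:
  assumes adj: "\<And>s. s \<in> S \<Longrightarrow> s + 1 \<notin> S" and wrap: "\<And>s. s \<in> S \<Longrightarrow> s + j \<notin> S"
    and j: "j + 1 = 2 * h" and dense: "\<not> card (S \<inter> {x..<x + (j + 1)}) \<le> h - 1"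
  shows "\<exists>y\<in>{x, x + 1}. \<forall>i<h. y + 2 * i \<in> S"
proof -
  define y where "y = (if x \<in> S then x else x + 1)"
  have sub: "S \<inter> {x..<x + (j + 1)} \<subseteq> S \<inter> {y..<y + j}"
  proof
    fix s assume s: "s \<in> S \<inter> {x..<x + (j + 1)}"
    show "s \<in> S \<inter> {y..<y + j}"
    proof (cases "x \<in> S")
      case True
      then have "x + j \<notin> S" using wrap by blast
      then have "s \<noteq> x + j" using s by auto
      then show ?thesis using s True unfolding y_def by auto
    next
      case False
      then have "s \<noteq> x" using s by auto
      then show ?thesis using s False unfolding y_def by auto
    qed
  qed
  have "y + 2 * i \<in> S" if i: "i < h" for i
  proof (rule ccontr)
    assume no: "y + 2 * i \<notin> S"
    have "S \<inter> {y..<y + j} \<subseteq>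
        (S \<inter> {y..<y + 2 * i}) \<union> (S \<inter> {y + 2 * i + 1..<y + 2 * i + 1 + 2 * (h - 1 - i)})"
    proof
      fix s assume s: "s \<in> S \<inter> {y..<y + j}"
      then have "s \<noteq> y + 2 * i" using no by auto
      then show "s \<in> (S \<inter> {y..<y + 2 * i}) \<union> (S \<inter> {y + 2 * i + 1..<y + 2 * i + 1 + 2 * (h - 1 - i)})"
        using s i j by auto
    qed
    with sub have "card (S \<inter> {x..<x + (j + 1)}) \<le> card ((S \<inter> {y..<y + 2 * i}) \<union>
        (S \<inter> {y + 2 * i + 1..<y + 2 * i + 1 + 2 * (h - 1 - i)}))"
      by (intro card_mono) auto
    also have "\<dots> \<le> card (S \<inter> {y..<y + 2 * i}) +
        card (S \<inter> {y + 2 * i + 1..<y + 2 * i + 1 + 2 * (h - 1 - i)})"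
      by (rule card_Un_le)
    also have "\<dots> \<le> i + (h - 1 - i)"
      by (intro add_mono card_sparse_le adj)
    finally show False using dense i by simp
  qed
  moreover have "y \<in> {x, x + 1}" unfolding y_def by simp
  ultimately show ?thesis by blast
qed

text \<open>An element of the parity of \<open>y\<close> below \<open>x + k\<close> is kept and one above is moved down by \<open>k\<close>;
  an element of the other parity is moved by \<open>j\<close> towards the alternating run at \<open>y\<close>. Elements
  that move land outside \<open>S\<close>, hence off the run, on opposite sides of it or at distance less
  than \<open>j\<close> from \<open>x\<close>, so that the result is an injection into one parity class of an interval
  of length \<open>k\<close>.\<close>

lemma card_le_of_alternating_run:
  assumes adj: "\<And>s. s \<in> S \<Longrightarrow> s + 1 \<notin> S" and Sj: "\<And>s. s \<in> S \<Longrightarrow> s + j \<notin> S"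
    and Sk: "\<And>s. s \<in> S \<Longrightarrow> s + k \<notin> S"
    and j: "j + 1 = 2 * h" and k: "even k"
    and y: "x \<le> y" "y \<le> x + k" and run: "\<And>i. i < h \<Longrightarrow> y + 2 * i \<in> S"
  shows "card (S \<inter> {x..<x + k + j}) \<le> k div 2"
proof -
  have "odd j" using j by presburger
  have runS: "s \<in> S" if "even (s + y)" "y \<le> s" "s < y + j" for s
  proof -
    have "s = y + 2 * ((s - y) div 2)" using that by presburger
    moreover have "(s - y) div 2 < h" using that j by linarith
    ultimately show ?thesis using run by metis
  qed
  \<comment> \<open>Otherwise \<open>y\<close> and \<open>y + k\<close> both lie on the run,
    \<open>k\<close> being even.\<close>
  have kj: "j \<le> k"
  proof (rule ccontr)
    assume "\<not> j \<le> k"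
    then have "y \<in> S" "y + k \<in> S" using k \<open>odd j\<close> by (auto intro!: runS simp: odd_pos)
    then show False using Sk by blast
  qed
  define f where "f s = (if even (s + y) then (if s < x + k then s else s - k)
      else if s < y then s + j else s - j)" for s
  let ?I = "S \<inter> {x..<x + k + j}"
  \<comment> \<open>As \<open>j\<close> is odd, \<open>s + j\<close> has the parity of
    \<open>y\<close>, so it would hit the run if it reached \<open>y\<close>.\<close>
  have low: "s + j < y" if "s \<in> S" "odd (s + y)" "s < y" for s
  proof (rule ccontr)
    assume "\<not> s + j < y"
    then have "s + j \<in> S" using that \<open>odd j\<close> by (intro runS) auto
    then show False using Sj that by blast
  qed
  \<comment> \<open>Below \<open>y + j\<close> the predecessor of \<open>s\<close> is on the run;
    from there up to \<open>y + 2 * j\<close> it is \<open>s - j\<close> that is on it.\<close>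
  have high: "y + 2 * j \<le> s" if "s \<in> S" "odd (s + y)" "y \<le> s" for s
  proof (rule ccontr)
    assume lt: "\<not> y + 2 * j \<le> s"
    have "s \<noteq> y" using that by auto
    show False
    proof (cases "s < y + j")
      case True
      have "s - 1 \<in> S" using True that \<open>s \<noteq> y\<close> by (intro runS) auto
      then show False using adj[of "s - 1"] that \<open>s \<noteq> y\<close> by simp
    next
      case False
      then have "s - j \<in> S" using that \<open>odd j\<close> lt by (intro runS) auto
      then show False using Sj[of "s - j"] that False by simp
    qed
  qed
  have kmove: "s - k \<notin> S" if "s \<in> S" "x + k \<le> s" for s
    using Sk[of "s - k"] that by auto
  have lmove: "s + j \<notin> S" if "s \<in> S" for s using Sj that by blast
  have hmove: "s - j \<notin> S" if "s \<in> S" "odd (s + y)" "y \<le> s" for s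
    using Sj[of "s - j"] that high[OF that] by auto
  \<comment> \<open>The inverse of \<open>f\<close>: a value in \<open>S\<close> was kept. Values
    moved down by \<open>k\<close> lie below \<open>x + j\<close>, those moved up by
    \<open>j\<close> lie in between \<open>x + j\<close> and \<open>y\<close>, and those moved down
    by \<open>j\<close> are at least \<open>y + j\<close>.\<close>
  define f' where "f' g = (if g \<in> S then g else if g < x + j then g + k
      else if g < y then g - j else g + j)" for g
  have inj: "inj_on f ?I"
  proof (rule inj_on_inverseI[of _ f'])
    fix s assume "s \<in> ?I"
    then have s: "s \<in> S" "x \<le> s" "s < x + k + j" by auto
    consider "even (s + y)" "s < x + k" | "even (s + y)" "x + k \<le> s"
      | "odd (s + y)" "s < y" | "odd (s + y)" "y \<le> s" by linarith
    then show "f' (f s) = s"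
    proof cases
      case 1
      then show ?thesis using s by (simp add: f_def f'_def)
    next
      case 2
      then have "s - k < x + j" "k \<le> s" using s by auto
      then show ?thesis using 2 s kmove[OF s(1) 2(2)] by (simp add: f_def f'_def)
    next
      case 3
      then show ?thesis using s low[OF s(1) 3] lmove[OF s(1)] by (simp add: f_def f'_def)
    next
      case 4
      then have "\<not> s - j < x + j" "\<not> s - j < y" "j \<le> s" using high[OF s(1) 4] y by auto
      then show ?thesis using 4 hmove[OF s(1) 4] by (simp add: f_def f'_def)
    qed
  qed
  \<comment> \<open>A parity class has no two consecutive elements, so the sparse bound applies to
    it.\<close>
  let ?G = "{g. even (g + y)}"
  have sub: "f ` ?I \<subseteq> ?G \<inter> {x..<x + 2 * (k div 2)}"
  proof
    fix g assume "g \<in> f ` ?I"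
    then obtain s where s: "s \<in> S" "x \<le> s" "s < x + k + j" "g = f s" by auto
    have "even g = even y" "x \<le> g" "g < x + k"
      using s kj y low[OF s(1)] high[OF s(1)] k \<open>odd j\<close> unfolding f_def
      by (auto split: if_splits)
    then show "g \<in> ?G \<inter> {x..<x + 2 * (k div 2)}" using k by simp
  qed
  have "card ?I = card (f ` ?I)" using inj by (simp add: card_image)
  also have "\<dots> \<le> card (?G \<inter> {x..<x + 2 * (k div 2)})" using sub by (intro card_mono) auto
  also have "\<dots> \<le> k div 2" by (intro card_sparse_le) auto
  finally show ?thesis .
qed

text \<open>An independent set in a cycle of odd length: one of the adjacent indices
  \<open>0\<close> and \<open>2 * n\<close> is missing, and the other \<open>2 * n\<close> indices
  form a path.\<close>

lemma card_odd_cycle_le: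
  assumes "\<And>i. i < 2 * n \<Longrightarrow> \<not> (P i \<and> P (Suc i))" "\<not> (P 0 \<and> P (2 * n))"
  shows "card {i \<in> {..<2 * n + 1}. P i} \<le> n"
proof -
  let ?S = "{i. i \<le> 2 * n \<and> P i}"
  have adj: "s + 1 \<notin> ?S" if "s \<in> ?S" for s using assms(1)[of s] that by auto
  define z where "z = (if P 0 then 0 else 1 :: nat)"
  have "{i \<in> {..<2 * n + 1}. P i} \<subseteq> ?S \<inter> {z..<z + 2 * n}"
  proof
    fix i assume i: "i \<in> {i \<in> {..<2 * n + 1}. P i}"
    then have "P 0 \<longrightarrow> i \<noteq> 2 * n" using assms(2) by blast
    moreover have "\<not> P 0 \<longrightarrow> i \<noteq> 0" using i by (metis (mono_tags, lifting) mem_Collect_eq)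
    ultimately show "i \<in> ?S \<inter> {z..<z + 2 * n}" using i unfolding z_def by auto
  qed
  then have "card {i \<in> {..<2 * n + 1}. P i} \<le> card (?S \<inter> {z..<z + 2 * n})"
    by (intro card_mono) auto
  also have "\<dots> \<le> n" using adj by (rule card_sparse_le)
  finally show ?thesis .
qed

section \<open>The three cases of the formula\<close>

theorem theorem2:
  fixes n j k m kbar :: nat and D :: "nat set"
  assumes "j = 4 * n + 3"
    and "even k" and "k > 0"
    and "real k \<le> real j * (real j - 1) / 2"
    and "D = {1, j, k}"
    and "k = m * (j + 1) + kbar" and "kbar \<le> j"
  shows "(int kbar = 2 * (int n - int m) \<and> m \<le> 2 * n \<longrightarrow>
            kappa D = mu D \<and> mu D = real n / (2 * real n + 1)) \<and>
         (max 0 (2 * (int n - int m + 1)) \<le> int kbar \<and> kbar \<le> 2 * n \<longrightarrow>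
            kappa D = mu D \<and> mu D = (real k - 2 * real m) / (2 * (real k + 1))) \<and>
         (kbar = 2 * (n + 1) \<longrightarrow>
            kappa D = mu D \<and> mu D = (2 * real n + 1) / (4 * real n + 4))"
proof -
  have D: "finite D" "D \<noteq> {}" using assms by auto
  have squeeze: "kappa D = mu D \<and> mu D = a" if "mu D \<le> a" "a \<le> kappa D" for a
    using that kappa_le_mu[OF D] by linarith
  have kappaI: "a \<le> kappa D" if "a \<le> nearest_int_dist t" "a \<le> nearest_int_dist (t * real j)"
    "a \<le> nearest_int_dist (t * real k)" for a t
    using that assms(5) by (intro kappa_ge[OF D, of _ t]) auto
  \<comment> \<open>Otherwise \<open>k\<close> is at least \<open>(2 * n + 1) * (j + 1)\<close>,
    whereas \<open>j * (j - 1) / 2\<close> equals \<open>(2 * n + 1) * j\<close>.\<close>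
  have "m \<le> 2 * n"
  proof (rule ccontr)
    assume "\<not> m \<le> 2 * n"
    then have "(2 * n + 1) * (4 * n + 4) \<le> m * (j + 1)" using assms(1) by (intro mult_mono) auto
    then have "real ((2 * n + 1) * (4 * n + 4)) \<le> real k"
      using assms(6) by (subst of_nat_le_iff) simp
    then show False using assms(1,4) by (simp add: algebra_simps)
  qed
  have kr: "real k = real m * (4 * real n + 4) + real kbar" using assms(1,6) by simp
  have "even kbar" using assms(1,2,6) by simp
  then obtain c where c: "kbar = 2 * c" by blast
  have adj: "s + 1 \<notin> S" and Sj: "s + j \<notin> S" and Sk: "s + k \<notin> S"
    if "D_sequence D S" "s \<in> S" for S s
    using D_sequence_add_notin[OF that] assms(5) by (metis insertI1 insertI2)+
  have jh: "j + 1 = 2 * (2 * n + 2)" using assms(1) by simp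
  \<comment> \<open>A window starting before \<open>x + k\<close> has its alternating run start at
    some \<open>y \<le> x + k\<close>, as the run lemma requires.\<close>
  have run_case: "real (card (S \<inter> {x..<x + (k + j)})) \<le> real k / 2"
    if S: "D_sequence D S" and i: "x + i * (j + 1) < x + k"
      and full: "\<not> card (S \<inter> {x + i * (j + 1)..<x + i * (j + 1) + (j + 1)}) \<le> 2 * n + 1" for S x i
  proof -
    have "\<not> card (S \<inter> {x + i * (j + 1)..<x + i * (j + 1) + (j + 1)}) \<le> 2 * n + 2 - 1"
      using full by simp
    then obtain y where y: "y \<in> {x + i * (j + 1), x + i * (j + 1) + 1}" "\<forall>i<2 * n + 2. y + 2 * i \<in> S"
      using window_sparse_or_alternating[OF adj[OF S] Sj[OF S] jh] by blast
    then have "card (S \<inter> {x..<x + k + j}) \<le> k div 2"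
      using i by (intro card_le_of_alternating_run[OF adj[OF S] Sj[OF S] Sk[OF S] jh assms(2),
            where y = y]) auto
    then have "2 * card (S \<inter> {x..<x + (k + j)}) \<le> k" using \<open>even k\<close> by (simp add: add.assoc)
    then show ?thesis by linarith
  qed
  have case1: "kappa D = mu D \<and> mu D = real n / (2 * real n + 1)"
    if A: "int kbar = 2 * (int n - int m)"
  proof (rule squeeze)
    have mc: "n = m + c" using A c by presburger
    \<comment> \<open>The closed walk: \<open>m + kbar\<close> steps of length 1, then steps of
      length \<open>j\<close>. Since \<open>2 * m + kbar = 2 * n\<close>, it reaches
      \<open>m * (j + 1) + kbar = k\<close> at index \<open>2 * n\<close>.\<close>
    define f where "f i = (if i \<le> m + kbar then i else m + kbar + (i - (m + kbar)) * j)" for i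
    have "mu D \<le> real n / real (2 * n + 1)"
    proof (rule mu_le_of_translates)
      fix S x assume S: "D_sequence D S"
      have f0: "f 0 = 0" unfolding f_def by simp
      have fn: "f (2 * n) = k" unfolding f_def using assms(6) mc c by (simp add: algebra_simps)
      have fS: "f (Suc i) = f i + 1 \<or> f (Suc i) = f i + j" for i
        unfolding f_def by (auto simp: Suc_diff_le not_le less_Suc_eq_le)
      show "card {i \<in> {..<2 * n + 1}. x + f i \<in> S} \<le> n"
      proof (rule card_odd_cycle_le)
        fix i
        show "\<not> (x + f i \<in> S \<and> x + f (Suc i) \<in> S)"
          using fS[of i] adj[OF S, of "x + f i"] Sj[OF S, of "x + f i"] by (auto simp: add.assoc)
      next
        show "\<not> (x + f 0 \<in> S \<and> x + f (2 * n) \<in> S)"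
          using Sk[OF S, of x] f0 fn by auto
      qed
    qed simp
    then show "mu D \<le> real n / (2 * real n + 1)" by (simp add: add.commute)
    have k': "real k = real m * (4 * real n + 2) + 2 * real n"
      using kr mc c by (simp add: algebra_simps)
    show "real n / (2 * real n + 1) \<le> kappa D"
    proof (rule kappaI)
      \<comment> \<open>Here \<open>?a * j = 2 * n + ?a\<close> and
        \<open>?a * k = 2 * m * n + n - ?a\<close>.\<close>
      let ?a = "real n / (2 * real n + 1)"
      show "?a \<le> nearest_int_dist ?a"
        by (rule nearest_int_dist_ge[of 0]) (simp_all add: field_simps)
      show "?a \<le> nearest_int_dist (?a * real j)"
        using assms(1) by (intro nearest_int_dist_ge[of "2 * int n"]) (simp_all add: field_simps)
      show "?a \<le> nearest_int_dist (?a * real k)"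
        unfolding k'
        by (intro nearest_int_dist_ge[of "2 * int m * int n + int n - 1"]) (simp_all add: field_simps)
    qed
  qed
  have case2: "kappa D = mu D \<and> mu D = (real k - 2 * real m) / (2 * (real k + 1))"
    if lo: "2 * (int n - int m + 1) \<le> int kbar" and hi: "kbar \<le> 2 * n"
  proof (rule squeeze)
    let ?a = "(real k - 2 * real m) / (2 * (real k + 1))"
    \<comment> \<open>The count for \<open>m\<close> sparse windows followed by \<open>2 * c\<close>
      further integers.\<close>
    define b where "b = m * (2 * n + 1) + c"
    have b: "real k - 2 * real m = 2 * real b" unfolding b_def using kr c by (simp add: algebra_simps)
    have a: "?a = real b / (real k + 1)" unfolding b by (rule mult_divide_mult_cancel_left) simp
    show "mu D \<le> ?a"
    proof (rule mu_le_of_dense_chunks[where L = "k + j"])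
      show "0 \<le> ?a" unfolding a by simp
      fix S x assume S: "D_sequence D S" "x \<in> S"
      show "\<exists>l\<ge>1. l \<le> k + j \<and> real (card (S \<inter> {x..<x + l})) \<le> ?a * real l"
      proof (cases "\<forall>i<m. card (S \<inter> {x + i * (j + 1)..<x + i * (j + 1) + (j + 1)}) \<le> 2 * n + 1")
        case True
        let ?z = "x + m * (j + 1)"
        \<comment> \<open>The chunk starts in \<open>S\<close>, so its last position is free; hence
          the denominator \<open>k + 1\<close>.\<close>
        have "x + k \<notin> S" using Sk S by blast
        have "S \<inter> {x..<x + (k + 1)} \<subseteq> (S \<inter> {x..<?z}) \<union> (S \<inter> {?z..<?z + 2 * c})"
        proof
          fix s assume s: "s \<in> S \<inter> {x..<x + (k + 1)}"
          then have "s \<noteq> x + k" using \<open>x + k \<notin> S\<close> by auto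
          then show "s \<in> (S \<inter> {x..<?z}) \<union> (S \<inter> {?z..<?z + 2 * c})"
            using s assms(6) c by auto
        qed
        then have "card (S \<inter> {x..<x + (k + 1)}) \<le> card ((S \<inter> {x..<?z}) \<union> (S \<inter> {?z..<?z + 2 * c}))"
          by (intro card_mono) auto
        also have "\<dots> \<le> card (S \<inter> {x..<?z}) + card (S \<inter> {?z..<?z + 2 * c})"
          by (rule card_Un_le)
        also have "\<dots> \<le> b"
          unfolding b_def using True adj[OF S(1)]
          by (intro add_mono card_rows_le card_sparse_le) auto
        finally have "real (card (S \<inter> {x..<x + (k + 1)})) \<le> real b" by (simp only: of_nat_le_iff)
        also have "real b = ?a * real (k + 1)" unfolding a by (simp add: field_simps)
        finally show ?thesis using assms(1) by (intro exI[of _ "k + 1"]) auto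
      next
        case False
        then obtain i where i: "i < m"
          "\<not> card (S \<inter> {x + i * (j + 1)..<x + i * (j + 1) + (j + 1)}) \<le> 2 * n + 1" by blast
        have "i * (j + 1) < m * (j + 1)" using i(1) by (intro mult_strict_right_mono) simp_all
        then have "x + i * (j + 1) < x + k" using assms(6) by linarith
        then have "real (card (S \<inter> {x..<x + (k + j)})) \<le> real k / 2"
          using run_case[OF S(1) _ i(2)] by blast
        \<comment> \<open>Cleared of denominators this reads
          \<open>2 * m * j \<le> (4 * n + 2 - 2 * m) * k\<close>; the factor is at least 2 and
          \<open>m * j \<le> k\<close>.\<close>
        also have "real k / 2 \<le> ?a * real (k + j)"
        proof -
          have "2 * (m * j) \<le> (4 * n + 2 - 2 * m) * (m * (j + 1))"
            using \<open>m \<le> 2 * n\<close> by (intro mult_mono) auto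
          also have "\<dots> \<le> (4 * n + 2 - 2 * m) * k" using assms(6) by (intro mult_left_mono) auto
          finally have "real (2 * (m * j)) \<le> real ((4 * n + 2 - 2 * m) * k)"
            by (simp only: of_nat_le_iff)
          then have "2 * (real m * real j) \<le> (4 * real n + 2 - 2 * real m) * real k"
            using \<open>m \<le> 2 * n\<close> by (simp add: of_nat_diff add.commute)
          then have "real k * (real k + 1) \<le> (real k - 2 * real m) * (real k + real j)"
            using assms(1) by (simp add: algebra_simps)
          then show ?thesis by (simp add: field_simps)
        qed
        finally show ?thesis using assms(1) by (intro exI[of _ "k + j"]) auto
      qed
    qed
    show "?a \<le> kappa D"
    proof (rule kappaI)
      have pos: "real k + 1 > 0" by simp
      have br: "real b = real m * (2 * real n + 1) + real c" unfolding b_def by (simp add: algebra_simps)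
      have kc: "real k = real m * (4 * real n + 4) + 2 * real c" using kr c by simp
      have "c \<le> n" "n + 1 \<le> m + c" using lo hi c by presburger+
      then have ineq: "real c \<le> real n" "real n + 1 \<le> real m + real c"
        by linarith+
      show "?a \<le> nearest_int_dist ?a"
        unfolding a using br kc
        by (intro nearest_int_dist_ge[of 0]) (simp_all add: field_simps)
      show "?a \<le> nearest_int_dist (?a * real j)"
      proof (rule nearest_int_dist_ge[of "2 * int n"])
        \<comment> \<open>After cancellation this amounts to \<open>n \<le> m + c\<close>, and the
          upper estimate below to \<open>2 * c \<le> 2 * n + 1\<close>.\<close>
        have "2 * real n * (real k + 1) + real b \<le> real b * real j"
          using ineq unfolding kc br assms(1) by (simp add: algebra_simps)
        from divide_right_mono[OF this less_imp_le[OF pos]]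
        show "of_int (2 * int n) + ?a \<le> ?a * real j"
          unfolding a using pos by (simp add: add_divide_distrib)
        have "real b * real j + real b \<le> (2 * real n + 1) * (real k + 1)"
          using ineq unfolding kc br assms(1) by (simp add: algebra_simps)
        from divide_right_mono[OF this less_imp_le[OF pos]]
        show "?a * real j \<le> of_int (2 * int n) + 1 - ?a"
          unfolding a using pos by (simp add: add_divide_distrib)
      qed
      \<comment> \<open>Because \<open>?a * (k + 1) = b\<close>.\<close>
      have "?a * real k = real b - ?a" unfolding a using pos by (simp add: field_simps)
      moreover have "2 * ?a \<le> 1" using pos by (simp add: field_simps)
      ultimately show "?a \<le> nearest_int_dist (?a * real k)"
        by (intro nearest_int_dist_ge[of "int b - 1"]) simp_all
    qed
  qed
  have case3: "kappa D = mu D \<and> mu D = (2 * real n + 1) / (4 * real n + 4)"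
    if kb: "kbar = 2 * (n + 1)"
  proof (rule squeeze)
    let ?a = "(2 * real n + 1) / (4 * real n + 4)"
    have k': "real k = real m * (4 * real n + 4) + 2 * real n + 2" using kr kb by simp
    show "mu D \<le> ?a"
    proof (rule mu_le_of_dense_chunks[where L = "k + j"])
      show "0 \<le> ?a" by simp
      fix S x assume S: "D_sequence D S" "x \<in> S"
      show "\<exists>l\<ge>1. l \<le> k + j \<and> real (card (S \<inter> {x..<x + l})) \<le> ?a * real l"
      \<comment> \<open>Only the first window matters: \<open>2 * n + 1\<close> is exactly
        \<open>?a * (j + 1)\<close>, so a sparse window is already a chunk.\<close>
      proof (cases "card (S \<inter> {x..<x + (j + 1)}) \<le> 2 * n + 1")
        case True
        then have "real (card (S \<inter> {x..<x + (j + 1)})) \<le> real (2 * n + 1)"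
          by (simp only: of_nat_le_iff)
        also have "\<dots> = ?a * real (j + 1)" using assms(1) by (simp add: field_simps)
        finally show ?thesis using assms(3) by (intro exI[of _ "j + 1"]) auto
      next
        case False
        then have "real (card (S \<inter> {x..<x + (k + j)})) \<le> real k / 2"
          using run_case[OF S(1), of x 0] assms(3) by simp
        also have "real k / 2 \<le> ?a * real (k + j)"
        proof -
          \<comment> \<open>The claim is equivalent to \<open>k \<le> (2 * n + 1) * j\<close>, and
            \<open>m \<le> 2 * n\<close> gives it with 1 to spare.\<close>
          have "real m \<le> 2 * real n" using \<open>m \<le> 2 * n\<close> by linarith
          then have "real m * (4 * real n + 4) \<le> 2 * real n * (4 * real n + 4)"
            by (intro mult_right_mono) auto
          then have "real k \<le> (2 * real n + 1) * real j"
            unfolding k' using assms(1) by (simp add: algebra_simps)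
          then show ?thesis by (simp add: field_simps)
        qed
        finally show ?thesis using assms(1) by (intro exI[of _ "k + j"]) auto
      qed
    qed
    show "?a \<le> kappa D"
    proof (rule kappaI)
      have le: "2 * ?a \<le> 1" by (simp add: field_simps)
      then show "?a \<le> nearest_int_dist ?a"
        by (intro nearest_int_dist_ge[of 0]) simp_all
      have "?a * real j = 2 * real n + 1 - ?a" using assms(1) by (simp add: field_simps)
      then show "?a \<le> nearest_int_dist (?a * real j)"
        using le by (intro nearest_int_dist_ge[of "2 * int n"]) simp_all
      \<comment> \<open>A half-integer, at the largest possible distance from the integers.\<close>
      have "?a * real k = real m * (2 * real n + 1) + real n + 1 / 2"
        unfolding k' by (simp add: field_simps)
      then show "?a \<le> nearest_int_dist (?a * real k)"
        using le by (intro nearest_int_dist_ge[of "int m * (2 * int n + 1) + int n"]) simp_all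
    qed
  qed
  show ?thesis using case1 case2 case3 by simp
qed

end
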